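(* Let $\alpha>0$, $\sigma>0$, $X_\natural(s,t) = \mathbf{1}\{|s|\le\alpha,|t|\le\alpha\}$, and $$\mathcal{C}(\mathbf{x}) = \Big\langle\nabla_{\mathbf{x}}[\varphi^{(2)}_{\sigma^2}\ast X_\natural](\mathbf{x}),\ \begin{bmatrix}0&-1\\1&0\end{bmatrix}\mathbf{x}\Big\rangle_{\ell^2},\qquad\mathbf{x}\in\mathbb{R}^2.$$ Let $\mathbf{Q}$ be one of the matrices $\begin{bmatrix}1&0\\0&-1\end{bmatrix},\begin{bmatrix}-1&0\\0&1\end{bmatrix},\begin{bmatrix}0&1\\1&0\end{bmatrix},\begin{bmatrix}0&-1\\-1&0\end{bmatrix}$ (the symmetries of the square of determinant $-1$). Then $\mathcal{C}(\mathbf{Q}\mathbf{x}) = -\mathcal{C}(\mathbf{x})$ for all $\mathbf{x}\in\mathbb{R}^2$.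
   Context: $\varphi^{(2)}_{\sigma^2}(\mathbf{x}) = (2\pi\sigma^2)^{-1}e^{-\|\mathbf{x}\|_2^2/(2\sigma^2)}$ and $\ast$ is convolution on $\mathbb{R}^2$. *)

theory Defs
  imports "HOL-Analysis.Analysis"
begin

text \<open>Two-dimensional centred Gaussian density with variance parameter v = sigma^2.\<close>
definition gauss2 :: "real \<Rightarrow> real^2 \<Rightarrow> real" where
  "gauss2 v x = exp (- (norm x)\<^sup>2 / (2 * v)) / (2 * pi * v)"

text \<open>Indicator of the square [-alpha,alpha]^2.\<close>
definition Xnat :: "real \<Rightarrow> real^2 \<Rightarrow> real" where
  "Xnat \<alpha> y = indicator {z :: real^2. \<bar>z$1\<bar> \<le> \<alpha> \<and> \<bar>z$2\<bar> \<le> \<alpha>} y"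

text \<open>Convolution on R^2 (Lebesgue integral).\<close>
definition conv2 :: "(real^2 \<Rightarrow> real) \<Rightarrow> (real^2 \<Rightarrow> real) \<Rightarrow> real^2 \<Rightarrow> real" where
  "conv2 f g x = (\<integral>y. f (x - y) * g y \<partial>lborel)"

text \<open>Gradient: the vector D with GDERIV f x :> D.\<close>
definition grad :: "(real^2 \<Rightarrow> real) \<Rightarrow> real^2 \<Rightarrow> real^2" where
  "grad f x = (THE D. GDERIV f x :> D)"

definition Jrot :: "real^2^2" where
  "Jrot = vector [vector [0, -1], vector [1, 0]]"

definition calC :: "real \<Rightarrow> real \<Rightarrow> real^2 \<Rightarrow> real" where
  "calC \<alpha> \<sigma> x = inner (grad (conv2 (gauss2 (\<sigma>\<^sup>2)) (Xnat \<alpha>)) x) (Jrot *v x)"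

end

theory Submission
  imports Defs
begin

(*
  Write F for the smoothed indicator of the square. Because the Gaussian only depends on the norm
  and the substitution y = Q u preserves Lebesgue measure when |det Q| = 1, F is invariant under
  every orthogonal Q that maps the square onto itself. Differentiating F (Q x) = F x gives
  grad F (Q x) = Q grad F x. For every 2x2 matrix, Q^T J Q = (det Q) J with J the rotation by a
  right angle, hence C (Q x) = <grad F x, Q^T J Q x> = (det Q) C x = - C x.
*)

lemma gderiv_unique:
  assumes "GDERIV f x :> D" and "GDERIV f x :> D'"
  shows "D = D'"
proof -
  have "(\<lambda>h. inner h D) = (\<lambda>h. inner h D')"
    using has_derivative_unique assms unfolding gderiv_def by blast
  then have "inner (D - D') D = inner (D - D') D'"
    by metis
  then have "inner (D - D') (D - D') = 0"
    by (simp add: inner_diff_left inner_commute)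
  then show ?thesis
    by simp
qed

lemma grad_eqI: "GDERIV f x :> D \<Longrightarrow> grad f x = D"
  unfolding grad_def using gderiv_unique by blast

lemma inner_matrix_vector_mult_transpose:
  fixes A :: "real^'n^'m"
  shows "inner (A *v h) (D :: real^'m) = inner (h :: real^'n) (transpose A *v D)"
  by (metis dot_lmul_matrix inner_commute transpose_matrix_vector)

lemma gderiv_compose_matrix:
  fixes A :: "real^'n^'m"
  assumes "GDERIV f (A *v x) :> D"
  shows "GDERIV (\<lambda>y. f (A *v y)) x :> transpose A *v D"
proof -
  have "((\<lambda>y. f (A *v y)) has_derivative (\<lambda>h. inner (A *v h) D)) (at x)"
    using has_derivative_compose[OF linear_imp_has_derivative[OF matrix_vector_mul_linear[of A]]
        assms[unfolded gderiv_def]] by simp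
  then show ?thesis
    unfolding gderiv_def inner_matrix_vector_mult_transpose .
qed

lemma grad_orthogonal_invariant:
  assumes "orthogonal_matrix Q" and "\<And>y. f (Q *v y) = f y" and "GDERIV f (Q *v x) :> D"
  shows "grad f (Q *v x) = Q *v grad f x"
proof -
  have "GDERIV f x :> transpose Q *v D"
    using gderiv_compose_matrix[OF assms(3)] assms(2) by simp
  then have "Q *v grad f x = Q *v (transpose Q *v D)"
    by (simp add: grad_eqI)
  also have "\<dots> = D"
    using assms(1)
    by (simp add: matrix_vector_mul_assoc orthogonal_matrix_def del: transpose_matrix_vector)
  finally show ?thesis
    using assms(3) by (simp add: grad_eqI)
qed

lemma integral_linear_image_invariant:
  fixes f :: "real^'n::{finite,wellorder} \<Rightarrow> real"
    and T :: "real^'n::_ \<Rightarrow> real^'n::_"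
  assumes "linear T" and "\<bar>det (matrix T)\<bar> = 1" and "T ` S = S"
    and "f absolutely_integrable_on S"
  shows "integral S (f \<circ> T) = integral S f"
proof -
  have vec_integral: "integral S (\<lambda>y. vec (g y) :: real^1) = vec (integral S g)" for g
    by (subst integral_on_1_eq) simp
  have "(\<lambda>y. vec (f y) :: real^1) absolutely_integrable_on T ` S"
    using assms(3,4) by (simp add: absolutely_integrable_on_1_iff)
  then have "integral (T ` S) (\<lambda>y. vec (f y) :: real^1)
      = \<bar>det (matrix T)\<bar> *\<^sub>R integral S ((\<lambda>y. vec (f y)) \<circ> T)"
    by (intro integral_change_of_variables_linear[OF assms(1)]) simp
  then show ?thesis
    using assms(2,3) by (simp add: o_def vec_integral)
qed

lemma conv2_indicator_eq_integral:
  assumes "continuous_on UNIV f" and "compact S"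
  shows "conv2 f (indicator S) x = integral S (\<lambda>y. f (x - y))"
proof -
  have "continuous_on S (\<lambda>y. f (x - y))"
    by (intro continuous_on_compose2[OF assms(1)] continuous_intros) auto
  then have "set_integrable lborel S (\<lambda>y. f (x - y))"
    unfolding set_integrable_def by (rule borel_integrable_compact[OF assms(2)])
  then have "(LINT y : S | lborel. f (x - y)) = integral S (\<lambda>y. f (x - y))"
    by (rule set_borel_integral_eq_integral(2))
  then show ?thesis
    unfolding conv2_def set_lebesgue_integral_def by (simp add: mult.commute)
qed

lemma conv2_indicator_linear_invariant:
  fixes Q :: "real^2^2"
  assumes "continuous_on UNIV f" and "compact S"
    and "\<bar>det Q\<bar> = 1" and "(*v) Q ` S = S" and "\<And>z. f (Q *v z) = f z"
  shows "conv2 f (indicator S) (Q *v x) = conv2 f (indicator S) x"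
proof -
  have "continuous_on S (\<lambda>y. f (Q *v x - y))"
    by (intro continuous_on_compose2[OF assms(1)] continuous_intros) auto
  then have "integrable lborel (\<lambda>y. indicator S y *\<^sub>R f (Q *v x - y))"
    by (rule borel_integrable_compact[OF assms(2)])
  then have "(\<lambda>y. f (Q *v x - y)) absolutely_integrable_on S"
    by (simp add: set_integrable_def integrable_completion borel_measurable_integrable)
  then have "integral S (\<lambda>y. f (Q *v x - y))
      = integral S ((\<lambda>y. f (Q *v x - y)) \<circ> (*v) Q)"
    by (intro integral_linear_image_invariant[symmetric]) (simp_all add: assms(3,4))
  also have "(\<lambda>y. f (Q *v x - y)) \<circ> (*v) Q = (\<lambda>y. f (x - y))"
    using assms(5) by (simp add: o_def flip: matrix_vector_mult_diff_distrib)
  finally show ?thesis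
    using conv2_indicator_eq_integral[OF assms(1,2)] by simp
qed

definition gauss2_grad :: "real \<Rightarrow> real^2 \<Rightarrow> real^2" where
  "gauss2_grad v z = (- gauss2 v z / v) *\<^sub>R z"

lemma continuous_on_gauss2: "v > 0 \<Longrightarrow> continuous_on A (gauss2 v)"
  unfolding gauss2_def by (intro continuous_intros) auto

lemma continuous_on_gauss2_grad: "v > 0 \<Longrightarrow> continuous_on A (gauss2_grad v)"
  unfolding gauss2_grad_def gauss2_def by (intro continuous_intros) auto

lemma gderiv_gauss2:
  assumes "v > 0"
  shows "GDERIV (gauss2 v) z :> gauss2_grad v z"
  unfolding gderiv_def gauss2_grad_def gauss2_def[abs_def] power2_norm_eq_inner
  by (rule derivative_eq_intros refl | simp)+
    (use assms in \<open>auto simp: field_simps inner_commute\<close>)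

lemma gauss2_orthogonal_invariant:
  assumes "orthogonal_matrix Q"
  shows "gauss2 v (Q *v z) = gauss2 v z"
proof -
  have "orthogonal_transformation ((*v) Q)"
    using assms by (simp add: orthogonal_transformation_matrix)
  then show ?thesis
    by (simp add: gauss2_def orthogonal_transformation_norm)
qed

lemma gderiv_conv2_gauss2_indicator_cbox:
  assumes "v > 0"
  shows "GDERIV (conv2 (gauss2 v) (indicator (cbox a b))) x
           :> integral (cbox a b) (\<lambda>y. gauss2_grad v (x - y))"
proof -
  have conv2_eq: "conv2 (gauss2 v) (indicator (cbox a b))
      = (\<lambda>x. integral (cbox a b) (\<lambda>y. gauss2 v (x - y)))"
    using conv2_indicator_eq_integral[OF continuous_on_gauss2[OF assms]] by auto
  have "((\<lambda>x. integral (cbox a b) (\<lambda>y. gauss2 v (x - y))) has_derivative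
      integral (cbox a b) (\<lambda>y. blinfun_inner_left (gauss2_grad v (x - y))))
      (at x within UNIV)"
  proof (rule leibniz_rule)
    show "((\<lambda>x. gauss2 v (x - y)) has_derivative blinfun_inner_left (gauss2_grad v (x - y)))
        (at x within UNIV)" for x y
    proof -
      have "((\<lambda>x. x - y) has_derivative (\<lambda>h. h)) (at x)"
        by (auto intro!: derivative_eq_intros)
      from has_derivative_compose[OF this gderiv_gauss2[OF assms, of "x - y", unfolded gderiv_def]]
      show ?thesis
        by simp
    qed
    show "(\<lambda>y. gauss2 v (x - y)) integrable_on cbox a b" for x
      by (intro integrable_continuous continuous_on_compose2[OF continuous_on_gauss2[OF assms]]
          continuous_intros) auto
    show "continuous_on (UNIV \<times> cbox a b)
        (\<lambda>(x, y). blinfun_inner_left (gauss2_grad v (x - y)))"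
      unfolding case_prod_unfold
      by (intro continuous_on_compose2[OF bounded_linear.continuous_on[OF
            bounded_linear_blinfun_inner_left]]
          continuous_on_compose2[OF continuous_on_gauss2_grad[OF assms]] continuous_intros) auto
  qed auto
  moreover have "(\<lambda>y. gauss2_grad v (x - y)) integrable_on cbox a b"
    by (intro integrable_continuous continuous_on_compose2[OF continuous_on_gauss2_grad[OF assms]]
        continuous_intros) auto
  then have "integral (cbox a b) (\<lambda>y. blinfun_inner_left (gauss2_grad v (x - y)))
      = blinfun_inner_left (integral (cbox a b) (\<lambda>y. gauss2_grad v (x - y)))"
    using integral_linear[OF _ bounded_linear_blinfun_inner_left] by (simp add: o_def)
  ultimately show ?thesis
    unfolding gderiv_def conv2_eq by (simp add: inner_commute)
qed

lemma transpose_Jrot_conj: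
  "transpose A *v (Jrot *v (A *v x)) = det A *\<^sub>R (Jrot *v (x::real^2))"
  unfolding Jrot_def
  by (simp add: vec_eq_iff forall_2 matrix_vector_mult_def sum_2 det_2 transpose_def algebra_simps)

definition square :: "real \<Rightarrow> (real^2) set" where
  "square a = cbox (- (\<chi> _. a)) (\<chi> _. a)"

lemma Xnat_eq_indicator_square: "Xnat a = indicator (square a)"
  unfolding Xnat_def square_def
  by (auto simp: mem_box_cart forall_2 abs_le_iff indicator_def fun_eq_iff)

definition square_reflections :: "(real^2^2) set" where
  "square_reflections =
     {vector [vector [1, 0], vector [0, -1]], vector [vector [-1, 0], vector [0, 1]],
      vector [vector [0, 1], vector [1, 0]], vector [vector [0, -1], vector [-1, 0]]}"

lemma square_reflectionsD:
  assumes "Q \<in> square_reflections"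
  shows "orthogonal_matrix Q" and "det Q = -1" and "(*v) Q ` square a = square a"
proof -
  have "Q *v (Q *v y) = y" and "y \<in> square a \<Longrightarrow> Q *v y \<in> square a" for y
    using assms
    by (auto simp: square_reflections_def square_def mem_box_cart forall_2 vec_eq_iff
        matrix_vector_mult_def sum_2)
  then show "(*v) Q ` square a = square a"
    by (metis image_subset_iff subset_antisym subsetI image_eqI)
  show "orthogonal_matrix Q" "det Q = -1"
    using assms
    by (auto simp: square_reflections_def orthogonal_matrix_def det_2 vec_eq_iff forall_2
        matrix_matrix_mult_def transpose_def mat_def sum_2)
qed

theorem mainTheorem9:
  fixes \<alpha> \<sigma> :: real and Q :: "real^2^2" and x :: "real^2"
  assumes "\<alpha> > 0" and "\<sigma> > 0"
    and "Q \<in> {vector [vector [1, 0], vector [0, -1]],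
              vector [vector [-1, 0], vector [0, 1]],
              vector [vector [0, 1], vector [1, 0]],
              vector [vector [0, -1], vector [-1, 0]]}"
  shows "calC \<alpha> \<sigma> (Q *v x) = - calC \<alpha> \<sigma> x"
proof -
  define F where "F = conv2 (gauss2 (\<sigma>\<^sup>2)) (Xnat \<alpha>)"
  have Q: "Q \<in> square_reflections"
    using assms(3) unfolding square_reflections_def .
  have var: "\<sigma>\<^sup>2 > 0"
    using assms(2) by simp
  have "compact (square \<alpha>)"
    by (simp add: square_def)
  then have F_invariant: "F (Q *v y) = F y" for y
    unfolding F_def Xnat_eq_indicator_square
    by (intro conv2_indicator_linear_invariant continuous_on_gauss2 var gauss2_orthogonal_invariant)
      (simp_all add: square_reflectionsD[OF Q])
  have F_gderiv: "GDERIV F y :> integral (square \<alpha>) (\<lambda>z. gauss2_grad (\<sigma>\<^sup>2) (y - z))"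
    for y
    unfolding F_def Xnat_eq_indicator_square square_def
    by (rule gderiv_conv2_gauss2_indicator_cbox[OF var])
  have "grad F (Q *v x) = Q *v grad F x"
    by (rule grad_orthogonal_invariant[where f = F,
          OF square_reflectionsD(1)[OF Q] F_invariant F_gderiv])
  then have "calC \<alpha> \<sigma> (Q *v x) = inner (grad F x) (transpose Q *v (Jrot *v (Q *v x)))"
    by (simp add: calC_def F_def inner_matrix_vector_mult_transpose del: transpose_matrix_vector)
  also have "\<dots> = - calC \<alpha> \<sigma> x"
    by (simp add: transpose_Jrot_conj square_reflectionsD(2)[OF Q] calC_def F_def
        del: transpose_matrix_vector)
  finally show ?thesis .
qed

end
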